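(* Consider an instance of the maintenance scheduling problem (with or without storage nodes), and let $t^*=(t^*_a)_{a\in A_1}$ be an optimal solution of $\varphi^*=\max\{\operatorname{val}(t^* ) : t^*\in X\}$. Let $0=t_0<t_1<\cdots<t_n=T$ be a conformal time discretization such that $\Gamma=\{t_0,\dots,t_n\}$ contains $\{t^*_a : a\in A_1\}$, and let $\underline{\varphi}$ be the optimal value of the associated lower bound integer program defined in the context. Then $\underline{\varphi}=\operatorname{val}(t^* )$.
   Context: The maintenance scheduling problem. $N=(V,A,s,t)$ is a finite directed network (parallel arcs allowed) with distinct source $s$ and sink $t$; $\delta^{\text{out}}(v)$ and $\delta^{\text{in}}(v)$ are the sets of arcs starting, respectively ending, at $v$. $W\subseteq V\setminus\{s,t\}$ is a set of storage nodes, and $u=(u_x)_{x\in A\cup W}$ are nonnegative capacities (flow per unit time for arcs, stored amount for nodes in $W$). $T>0$ is the time horizon. $A_1\subseteq A$ is the set of arcs with a maintenance job; each $a\in A_1$ has exactly one job, with processing time $p_a>0$, release time $r_a$ and deadline $d_a$, where $0\leqslant r_a\leqslant d_a-p_a$ and $d_a\leqslant T$. A feasible solution is a start time vector $t^*=(t^*_a)_{a\in A_1}\in X:=\prod_{a\in A_1}[r_a,d_a-p_a]$. Value of a solution. Given $t^*\in X$, let $0=\tau_0<\tau_1<\cdots<\tau_m=T$ be the increasing enumeration of the set $\{t^*_a : a\in A_1\}\cup\{t^*_a+p_a : a\in A_1\}\cup\{0,T\}$, and for $a\in A_1$ let $I_a=\{i\in\{1,\dots,m\} : t^*_a<\tau_i\leqslant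 t^*_a+p_a\}$. Then $\operatorname{val}(t^* )$ is the maximum of $\sum_{i=1}^m\big(\sum_{a\in\delta^{\text{out}}(s)}x_{ai}-\sum_{a\in\delta^{\text{in}}(s)}x_{ai}\big)$ over all nonnegative reals $x_{ai}$ ($a\in A$, $1\leqslant i\leqslant m$) and $x_{vi}$ ($v\in W$, $0\leqslant i\leqslant m$) satisfying: $\sum_{a\in\delta^{\text{out}}(v)}x_{ai}=\sum_{a\in\delta^{\text{in}}(v)}x_{ai}$ for $v\in V\setminus(W\cup\{s,t\})$, $1\leqslant i\leqslant m$; $\sum_{a\in\delta^{\text{out}}(v)}x_{ai}+x_{vi}=\sum_{a\in\delta^{\text{in}}(v)}x_{ai}+x_{v,i-1}$ for $v\in W$, $1\leqslant i\leqslant m$; $x_{ai}\leqslant(\tau_i-\tau_{i-1})u_a$ for $a\in A\setminus A_1$ and all $i$, and for $a\in A_1$ and $i\notin I_a$; $x_{ai}=0$ for $a\in A_1$, $i\in I_a$; $x_{vi}\leqslant u_v$ for $v\in W$, $0\leqslant i\leqslant m$; $x_{v0}=x_{vm}=0$ for $v\in W$. An optimal solution is a $t^*\in X$ maximizing $\operatorname{val}$ over $X$. Conformal discretization. A discretization $0=t_0<t_1<\cdots<t_n=T$ with $\Gamma=\{t_0,\dots,t_n\}$ is conformal if (i) $\bigcup_{a\in A_1}\{r_a,d_a\}\subseteq\Gamma$, and (ii) for any $i\in\{0,\dots,n\}$ and any $a\in A_1$: if $t_i\in[r_a,d_a-p_a]$ then $t_i+p_a\in\Gamma$, and if $t_i\in[r_a+p_a,d_a]$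 then $t_i-p_a\in\Gamma$. Lower bound integer program. For $a\in A_1$ let $\mathcal S_a=\{i\in\{1,\dots,n\} : r_a<t_i,\ d_a-p_a\geqslant t_{i-1}\}$ and $\mathcal T_a=\{i\in\{1,\dots,n\} : d_a>t_{i-1},\ r_a<t_i\}$; for $i\in\mathcal S_a$ let $Q_{ai}=\{k\in\mathcal T_a : k\geqslant i,\ t_i+p_a>t_{k-1}\}$; for $i\in\mathcal T_a$ let $P_{ai}=\{k\in\mathcal S_a : t_{k-1}\leqslant t_{i-1},\ t_{k-1}+p_a\geqslant t_i\}$ (the set of $k$ such that a job on $a$ started at $t_{k-1}$ is processed during the whole of interval $i$). The variables are $x_{ai}\geqslant0$ ($a\in A$, $1\leqslant i\leqslant n$), $x_{vi}\geqslant 0$ ($v\in W$, $0\leqslant i\leqslant n$), $y_{ai}\in\{0,1\}$ ($a\in A_1$, $i\in\mathcal S_a$), $z_{ai}\in\{0,1\}$ ($a\in A_1$, $i\in\mathcal T_a$). The program maximizes $\sum_{i=1}^n\big(\sum_{a\in\delta^{\text{out}}(s)}x_{ai}-\sum_{a\in\delta^{\text{in}}(s)}x_{ai}\big)$ subject to: 1. $\sum_{a\in\delta^{\text{out}}(v)}x_{ai}=\sum_{a\in\delta^{\text{in}}(v)}x_{ai}$ for $v\in V\setminus(W\cup\{s,t\})$, $1\leqslant i\leqslant n$; 2. $\sum_{a\in\delta^{\text{out}}(v)}x_{ai}+x_{vi}=\sum_{a\in\delta^{\text{in}}(v)}x_{ai}+x_{v,i-1}$ for $v\in W$, $1\leqslant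 i\leqslant n$; 3. $x_{ai}\leqslant(t_i-t_{i-1})u_a$ for $a\in A\setminus A_1$, $1\leqslant i\leqslant n$; 4. $x_{vi}\leqslant u_v$ for $v\in W$, $0\leqslant i\leqslant n$, and $x_{v0}=x_{vn}=0$ for $v\in W$; 5. $\sum_{i\in\mathcal S_a}y_{ai}=1$ for $a\in A_1$; 6. $(t_i-t_{i-1})z_{ai}\leqslant\min\{t_i,d_a\}-\max\{t_{i-1},r_a\}$ for $a\in A_1$, $i\in\mathcal T_a$; 7. $\sum_{i\in\mathcal T_a}(t_i-t_{i-1})z_{ai}=p_a$ for $a\in A_1$; 8. $\sum_{k\in Q_{ai}}(t_k-t_{k-1})z_{ak}\geqslant p_a y_{ai}$ for $a\in A_1$, $i\in\mathcal S_a$; 9. $z_{ai}=\sum_{k\in P_{ai}}y_{ak}$ for $a\in A_1$, $i\in\mathcal T_a$; 10. $x_{ai}\leqslant(t_i-t_{i-1})(1-z_{ai})u_a$ for $a\in A_1$, $i\in\mathcal T_a$; 11. $x_{ai}\leqslant(t_i-t_{i-1})u_a$ for $a\in A_1$, $i\in\{1,\dots,n\}\setminus\mathcal T_a$. *)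

theory Defs
  imports Complex_Main "HOL-Library.FuncSet" "Graph_Theory.Digraph"
begin

text \<open>
  The network is a \<^locale>\<open>fin_digraph\<close>, so parallel arcs (and loops) are allowed.
  The capacity vector indexed by arcs and storage nodes is split into
  \<open>arc_cap\<close> and \<open>node_cap\<close>.
\<close>

record ('v, 'a) maintenance =
  net :: "('v, 'a) pre_digraph"
  source :: 'v
  sink :: 'v
  storage :: "'v set"
  arc_cap :: "'a \<Rightarrow> real"
  node_cap :: "'v \<Rightarrow> real"
  horizon :: real
  jobs :: "'a set"
  proc :: "'a \<Rightarrow> real"
  release :: "'a \<Rightarrow> real"
  deadline :: "'a \<Rightarrow> real"

definition maintenance_instance :: "('v, 'a) maintenance \<Rightarrow> bool" where
  "maintenance_instance I \<longleftrightarrow>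
     fin_digraph (net I) \<and>
     source I \<in> verts (net I) \<and> sink I \<in> verts (net I) \<and> source I \<noteq> sink I \<and>
     storage I \<subseteq> verts (net I) - {source I, sink I} \<and>
     (\<forall>a\<in>arcs (net I). 0 \<le> arc_cap I a) \<and>
     (\<forall>v\<in>storage I. 0 \<le> node_cap I v) \<and>
     0 < horizon I \<and>
     jobs I \<subseteq> arcs (net I) \<and>
     (\<forall>a\<in>jobs I. 0 < proc I a \<and> 0 \<le> release I a \<and>
        release I a \<le> deadline I a - proc I a \<and> deadline I a \<le> horizon I)"

definition schedules :: "('v, 'a) maintenance \<Rightarrow> ('a \<Rightarrow> real) set" where
  "schedules I = (\<Pi>\<^sub>E a\<in>jobs I. {release I a .. deadline I a - proc I a})"


subsection \<open>Flows over a sequence of time intervals\<close>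

text \<open>
  \<open>x a i\<close> is the flow on arc \<open>a\<close> in the interval \<open>i \<in> {1..m}\<close>, and \<open>w v i\<close> is the amount
  stored at node \<open>v\<close> at the end of interval \<open>i\<close>. The conditions collected here
  are the ones shared by the linear program defining the value of a schedule and the lower
  bound integer program.
\<close>

definition storage_flow ::
  "('v, 'a) maintenance \<Rightarrow> nat \<Rightarrow> ('a \<Rightarrow> nat \<Rightarrow> real) \<Rightarrow> ('v \<Rightarrow> nat \<Rightarrow> real) \<Rightarrow> bool" where
  "storage_flow I m x w \<longleftrightarrow>
     (\<forall>a\<in>arcs (net I). \<forall>i\<in>{1..m}. 0 \<le> x a i) \<and>
     (\<forall>v\<in>storage I. \<forall>i\<in>{0..m}. 0 \<le> w v i) \<and>
     (\<forall>v\<in>verts (net I) - (storage I \<union> {source I, sink I}). \<forall>i\<in>{1..m}.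
        (\<Sum>a\<in>out_arcs (net I) v. x a i) = (\<Sum>a\<in>in_arcs (net I) v. x a i)) \<and>
     (\<forall>v\<in>storage I. \<forall>i\<in>{1..m}.
        (\<Sum>a\<in>out_arcs (net I) v. x a i) + w v i =
        (\<Sum>a\<in>in_arcs (net I) v. x a i) + w v (i - 1)) \<and>
     (\<forall>v\<in>storage I. \<forall>i\<in>{0..m}. w v i \<le> node_cap I v) \<and>
     (\<forall>v\<in>storage I. w v 0 = 0 \<and> w v m = 0)"

definition flow_value :: "('v, 'a) maintenance \<Rightarrow> nat \<Rightarrow> ('a \<Rightarrow> nat \<Rightarrow> real) \<Rightarrow> real" where
  "flow_value I m x =
     (\<Sum>i\<in>{1..m}. (\<Sum>a\<in>out_arcs (net I) (source I). x a i) -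
                   (\<Sum>a\<in>in_arcs (net I) (source I). x a i))"


subsection \<open>Value of a schedule\<close>

definition breakpoints :: "('v, 'a) maintenance \<Rightarrow> ('a \<Rightarrow> real) \<Rightarrow> real set" where
  "breakpoints I ts = ts ` jobs I \<union> (\<lambda>a. ts a + proc I a) ` jobs I \<union> {0, horizon I}"

definition tau :: "('v, 'a) maintenance \<Rightarrow> ('a \<Rightarrow> real) \<Rightarrow> nat \<Rightarrow> real" where
  "tau I ts i = sorted_list_of_set (breakpoints I ts) ! i"

definition num_intervals :: "('v, 'a) maintenance \<Rightarrow> ('a \<Rightarrow> real) \<Rightarrow> nat" where
  "num_intervals I ts = card (breakpoints I ts) - 1"

definition closed_intervals :: "('v, 'a) maintenance \<Rightarrow> ('a \<Rightarrow> real) \<Rightarrow> 'a \<Rightarrow> nat set" where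
  "closed_intervals I ts a =
     {i\<in>{1..num_intervals I ts}. ts a < tau I ts i \<and> tau I ts i \<le> ts a + proc I a}"

definition schedule_flow ::
  "('v, 'a) maintenance \<Rightarrow> ('a \<Rightarrow> real) \<Rightarrow> ('a \<Rightarrow> nat \<Rightarrow> real) \<Rightarrow> ('v \<Rightarrow> nat \<Rightarrow> real) \<Rightarrow> bool" where
  "schedule_flow I ts x w \<longleftrightarrow>
     storage_flow I (num_intervals I ts) x w \<and>
     (\<forall>a\<in>arcs (net I) - jobs I. \<forall>i\<in>{1..num_intervals I ts}.
        x a i \<le> (tau I ts i - tau I ts (i - 1)) * arc_cap I a) \<and>
     (\<forall>a\<in>jobs I. \<forall>i\<in>{1..num_intervals I ts} - closed_intervals I ts a.
        x a i \<le> (tau I ts i - tau I ts (i - 1)) * arc_cap I a) \<and>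
     (\<forall>a\<in>jobs I. \<forall>i\<in>closed_intervals I ts a. x a i = 0)"

definition schedule_value :: "('v, 'a) maintenance \<Rightarrow> ('a \<Rightarrow> real) \<Rightarrow> real" where
  "schedule_value I ts =
     (GREATEST \<phi>. \<exists>x w. schedule_flow I ts x w \<and> \<phi> = flow_value I (num_intervals I ts) x)"

definition optimal_schedule :: "('v, 'a) maintenance \<Rightarrow> ('a \<Rightarrow> real) \<Rightarrow> bool" where
  "optimal_schedule I ts \<longleftrightarrow> is_arg_max (schedule_value I) (\<lambda>ts'. ts' \<in> schedules I) ts"


subsection \<open>Conformal discretizations\<close>

definition discretization :: "('v, 'a) maintenance \<Rightarrow> nat \<Rightarrow> (nat \<Rightarrow> real) \<Rightarrow> bool" where
  "discretization I n g \<longleftrightarrow> g 0 = 0 \<and> g n = horizon I \<and> strict_mono_on {0..n} g"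

definition conformal :: "('v, 'a) maintenance \<Rightarrow> nat \<Rightarrow> (nat \<Rightarrow> real) \<Rightarrow> bool" where
  "conformal I n g \<longleftrightarrow>
     (\<Union>a\<in>jobs I. {release I a, deadline I a}) \<subseteq> g ` {0..n} \<and>
     (\<forall>i\<in>{0..n}. \<forall>a\<in>jobs I.
        (g i \<in> {release I a .. deadline I a - proc I a} \<longrightarrow> g i + proc I a \<in> g ` {0..n}) \<and>
        (g i \<in> {release I a + proc I a .. deadline I a} \<longrightarrow> g i - proc I a \<in> g ` {0..n}))"


subsection \<open>Lower bound integer program\<close>

definition start_set :: "('v, 'a) maintenance \<Rightarrow> nat \<Rightarrow> (nat \<Rightarrow> real) \<Rightarrow> 'a \<Rightarrow> nat set" where
  "start_set I n g a =
     {i\<in>{1..n}. release I a < g i \<and> deadline I a - proc I a \<ge> g (i - 1)}"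

definition process_set :: "('v, 'a) maintenance \<Rightarrow> nat \<Rightarrow> (nat \<Rightarrow> real) \<Rightarrow> 'a \<Rightarrow> nat set" where
  "process_set I n g a = {i\<in>{1..n}. deadline I a > g (i - 1) \<and> release I a < g i}"

definition Q_set :: "('v, 'a) maintenance \<Rightarrow> nat \<Rightarrow> (nat \<Rightarrow> real) \<Rightarrow> 'a \<Rightarrow> nat \<Rightarrow> nat set" where
  "Q_set I n g a i = {k\<in>process_set I n g a. k \<ge> i \<and> g i + proc I a > g (k - 1)}"

definition P_set :: "('v, 'a) maintenance \<Rightarrow> nat \<Rightarrow> (nat \<Rightarrow> real) \<Rightarrow> 'a \<Rightarrow> nat \<Rightarrow> nat set" where
  "P_set I n g a i =
     {k\<in>start_set I n g a. g (k - 1) \<le> g (i - 1) \<and> g (k - 1) + proc I a \<ge> g i}"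

definition lower_bound_feasible ::
  "('v, 'a) maintenance \<Rightarrow> nat \<Rightarrow> (nat \<Rightarrow> real) \<Rightarrow> ('a \<Rightarrow> nat \<Rightarrow> real) \<Rightarrow> ('v \<Rightarrow> nat \<Rightarrow> real)
     \<Rightarrow> ('a \<Rightarrow> nat \<Rightarrow> real) \<Rightarrow> ('a \<Rightarrow> nat \<Rightarrow> real) \<Rightarrow> bool" where
  "lower_bound_feasible I n g x w y z \<longleftrightarrow>
     storage_flow I n x w \<and>
     (\<forall>a\<in>jobs I. \<forall>i\<in>start_set I n g a. y a i \<in> {0, 1}) \<and>
     (\<forall>a\<in>jobs I. \<forall>i\<in>process_set I n g a. z a i \<in> {0, 1}) \<and>
     (\<forall>a\<in>arcs (net I) - jobs I. \<forall>i\<in>{1..n}. x a i \<le> (g i - g (i - 1)) * arc_cap I a) \<and>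
     (\<forall>a\<in>jobs I. (\<Sum>i\<in>start_set I n g a. y a i) = 1) \<and>
     (\<forall>a\<in>jobs I. \<forall>i\<in>process_set I n g a.
        (g i - g (i - 1)) * z a i \<le> min (g i) (deadline I a) - max (g (i - 1)) (release I a)) \<and>
     (\<forall>a\<in>jobs I. (\<Sum>i\<in>process_set I n g a. (g i - g (i - 1)) * z a i) = proc I a) \<and>
     (\<forall>a\<in>jobs I. \<forall>i\<in>start_set I n g a.
        (\<Sum>k\<in>Q_set I n g a i. (g k - g (k - 1)) * z a k) \<ge> proc I a * y a i) \<and>
     (\<forall>a\<in>jobs I. \<forall>i\<in>process_set I n g a. z a i = (\<Sum>k\<in>P_set I n g a i. y a k)) \<and>
     (\<forall>a\<in>jobs I. \<forall>i\<in>process_set I n g a.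
        x a i \<le> (g i - g (i - 1)) * (1 - z a i) * arc_cap I a) \<and>
     (\<forall>a\<in>jobs I. \<forall>i\<in>{1..n} - process_set I n g a.
        x a i \<le> (g i - g (i - 1)) * arc_cap I a)"

definition lower_bound_values ::
  "('v, 'a) maintenance \<Rightarrow> nat \<Rightarrow> (nat \<Rightarrow> real) \<Rightarrow> real set" where
  "lower_bound_values I n g =
     {flow_value I n x | x w y z. lower_bound_feasible I n g x w y z}"

definition lower_bound_optimum :: "('v, 'a) maintenance \<Rightarrow> nat \<Rightarrow> (nat \<Rightarrow> real) \<Rightarrow> real" where
  "lower_bound_optimum I n g = (GREATEST \<phi>. \<phi> \<in> lower_bound_values I n g)"

end

(*
A choice of y amounts to a start time vector whose entries lie in Gamma, and constraint 9 then forces z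
to mark exactly the grid intervals in which each arc is closed. So the program maximizes, over all
schedules with start times in Gamma, the value of a flow on the grid Gamma. By conformality Gamma
contains all breakpoints of such a schedule, and refining the time grid beyond the breakpoints does
not change the optimal flow value: flows on the fine grid are summed over each coarse interval, flows
on the coarse grid are spread uniformly in time with the storage levels interpolated linearly, and
convexity keeps these levels within the node capacities.
*)

theory Submission
  imports Defs "HOL-Analysis.Function_Topology"
begin

section \<open>Flows with arbitrary arc bounds\<close>

text \<open>\<open>schedule_value\<close> and \<open>lower_bound_optimum\<close> are
  \<open>GREATEST\<close> terms, which carry no information until a maximum is known to exist. For a
  fixed schedule its existence comes from compactness. For the program it comes out of the
  comparison itself: the value of \<open>tstar\<close> is attained by a feasible point and bounds
  the value of every other one, because each feasible point yields some element of
  \<open>schedules I\<close>, to which the optimality of \<open>tstar\<close> applies.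

  The two problems differ in their grids and in the shape of their capacity constraints.
  \<open>bounded_flow\<close> is the common form: a closed arc gets the bound 0, and every bound is
  an interval length times a rate. Comparing the grids then rests on the rates being constant on
  each coarse interval.

  Conformality is used in two ways. It puts the end of each job on the grid, and it makes each
  release time a grid point, so that the left end of an interval in \<open>start_set\<close> is an
  admissible start time.\<close>

definition bounded_flow ::
  "('v, 'a) maintenance \<Rightarrow> nat \<Rightarrow> ('a \<Rightarrow> nat \<Rightarrow> real) \<Rightarrow> ('a \<Rightarrow> nat \<Rightarrow> real) \<Rightarrow> ('v \<Rightarrow> nat \<Rightarrow> real) \<Rightarrow> bool"
  where "bounded_flow I m c x w \<longleftrightarrow>
     storage_flow I m x w \<and> (\<forall>a\<in>arcs (net I). \<forall>i\<in>{1..m}. x a i \<le> c a i)"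

text \<open>Only the values at actual arcs, storage nodes and intervals matter. A flow may therefore
  be set to 0 elsewhere, which brings an arbitrary competitor into the compact box of
  \<open>bounded_flow_maximum\<close>.\<close>

lemma storage_flow_cong:
  assumes "\<And>a i. a \<in> arcs (net I) \<Longrightarrow> i \<in> {1..m} \<Longrightarrow> x a i = x' a i"
    and "\<And>v i. v \<in> storage I \<Longrightarrow> i \<in> {0..m} \<Longrightarrow> w v i = w' v i"
  shows "storage_flow I m x w \<longleftrightarrow> storage_flow I m x' w'"
proof -
  have out: "(\<Sum>a\<in>out_arcs (net I) v. x a i) = (\<Sum>a\<in>out_arcs (net I) v. x' a i)"
    and "in": "(\<Sum>a\<in>in_arcs (net I) v. x a i) = (\<Sum>a\<in>in_arcs (net I) v. x' a i)"
    if "i \<in> {1..m}" for v i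
    using assms(1) that by (auto intro!: sum.cong)
  have pred: "w v (i - 1) = w' v (i - 1)" if "v \<in> storage I" "i \<in> {1..m}" for v i
    using assms(2)[of v "i - 1"] that by auto
  have ends: "w v 0 = w' v 0" "w v m = w' v m" if "v \<in> storage I" for v
    using assms(2) that by auto
  show ?thesis
    unfolding storage_flow_def
    by (intro conj_cong ball_cong refl) (simp_all add: assms out "in" pred ends del: One_nat_def)
qed

lemma flow_value_cong:
  assumes "\<And>a i. a \<in> arcs (net I) \<Longrightarrow> i \<in> {1..m} \<Longrightarrow> x a i = x' a i"
  shows "flow_value I m x = flow_value I m x'"
  unfolding flow_value_def using assms
  by (intro sum.cong arg_cong2[where f = "(-)"]) auto

text \<open>Tychonoff's theorem for total functions. Flows are functions on whole types with
  infinitely many coordinates, although only finitely many of these matter, so compactness is taken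
  in the product topology.\<close>

lemma compact_PiE_UNIV:
  fixes S :: "'i \<Rightarrow> 'b::topological_space set"
  assumes "\<And>i. compact (S i)"
  shows "compact (PiE UNIV S)"
  using assms compactin_PiE[of "\<lambda>_. euclidean" UNIV S]
  by (simp add: euclidean_product_topology)

lemma continuous_on_fst_apply2 [continuous_intros]:
  "continuous_on UNIV (\<lambda>p :: ('a \<Rightarrow> nat \<Rightarrow> real) \<times> ('v \<Rightarrow> nat \<Rightarrow> real). fst p a i)"
  by (rule continuous_on_product_then_coordinatewise[OF continuous_on_product_then_coordinatewise[OF
        continuous_on_fst[OF continuous_on_id]]])

lemma continuous_on_snd_apply2 [continuous_intros]:
  "continuous_on UNIV (\<lambda>p :: ('a \<Rightarrow> nat \<Rightarrow> real) \<times> ('v \<Rightarrow> nat \<Rightarrow> real). snd p a i)"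
  by (rule continuous_on_product_then_coordinatewise[OF continuous_on_product_then_coordinatewise[OF
        continuous_on_snd[OF continuous_on_id]]])

lemma closed_storage_flow:
  "closed {p :: ('a \<Rightarrow> nat \<Rightarrow> real) \<times> ('v \<Rightarrow> nat \<Rightarrow> real). storage_flow I m (fst p) (snd p)}"
  \<comment> \<open>Bounded quantifiers become implications with constant premises, the form to
    which \<open>closed_Collect_imp\<close> applies.\<close>
  unfolding storage_flow_def Ball_def
  by (intro closed_Collect_conj closed_Collect_all closed_Collect_imp open_Collect_const
      closed_Collect_le closed_Collect_eq continuous_intros)

lemma bounded_flow_maximum:
  assumes cap: "\<And>a i. a \<in> arcs (net I) \<Longrightarrow> i \<in> {1..m} \<Longrightarrow> 0 \<le> c a i"
    and node_cap: "\<And>v. v \<in> storage I \<Longrightarrow> 0 \<le> node_cap I v"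
  shows "\<exists>x w. bounded_flow I m c x w \<and>
    (\<forall>x' w'. bounded_flow I m c x' w' \<longrightarrow> flow_value I m x' \<le> flow_value I m x)"
proof -
  \<comment> \<open>Nothing is assumed about \<open>c\<close> and \<open>node_cap\<close> off the
    actual indices. The value 0 there keeps the box nonempty and is met by truncated flows.\<close>
  define C where "C a i = (if a \<in> arcs (net I) \<and> i \<in> {1..m} then c a i else 0)" for a i
  define D where "D v i = (if v \<in> storage I \<and> i \<in> {0..m} then node_cap I v else 0)" for v and i :: nat
  define K where "K = (PiE UNIV (\<lambda>a. PiE UNIV (\<lambda>i. {0..C a i}))) \<times> (PiE UNIV (\<lambda>v. PiE UNIV (\<lambda>i. {0..D v i})))"
  define S where "S = {p. storage_flow I m (fst p) (snd p)}"
  have "compact (K \<inter> S)"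
    unfolding K_def S_def
    by (intro compact_Int_closed compact_Times compact_PiE_UNIV compact_Icc closed_storage_flow)
  moreover have "((\<lambda>_ _. 0), (\<lambda>_ _. 0)) \<in> K \<inter> S"
    using cap node_cap by (auto simp: K_def S_def C_def D_def storage_flow_def)
  moreover have "continuous_on (K \<inter> S) (\<lambda>p. flow_value I m (fst p))"
    unfolding flow_value_def
    by (rule continuous_on_subset[OF _ subset_UNIV]) (intro continuous_intros)
  ultimately obtain p where p: "p \<in> K \<inter> S"
    and max: "\<And>q. q \<in> K \<inter> S \<Longrightarrow> flow_value I m (fst q) \<le> flow_value I m (fst p)"
    using continuous_attains_sup[of "K \<inter> S" "\<lambda>p. flow_value I m (fst p)"] by blast
  show ?thesis
  proof (intro exI conjI allI impI)
    have "fst p a i \<le> C a i" for a i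
      using p by (auto simp: K_def PiE_iff mem_Times_iff)
    then show "bounded_flow I m c (fst p) (snd p)"
      using p unfolding bounded_flow_def S_def C_def by (smt (verit) Int_iff mem_Collect_eq)
  next
    fix x' w' assume b: "bounded_flow I m c x' w'"
    define x where "x a i = (if a \<in> arcs (net I) \<and> i \<in> {1..m} then x' a i else 0)" for a i
    define w where "w v i = (if v \<in> storage I \<and> i \<in> {0..m} then w' v i else 0)" for v i
    have "storage_flow I m x w"
      using b storage_flow_cong[of I m x x' w w'] by (auto simp: bounded_flow_def x_def w_def)
    moreover have "(x, w) \<in> K"
    proof -
      have "x a i \<in> {0..C a i}" for a i
        using b by (simp add: bounded_flow_def storage_flow_def x_def C_def)
      moreover have "w v i \<in> {0..D v i}" for v i
        using b by (simp add: bounded_flow_def storage_flow_def w_def D_def)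
      ultimately show ?thesis by (simp add: K_def PiE_UNIV_domain)
    qed
    ultimately have "flow_value I m x \<le> flow_value I m (fst p)"
      using max[of "(x, w)"] by (simp add: S_def)
    then show "flow_value I m x' \<le> flow_value I m (fst p)"
      using flow_value_cong[of I m x x'] by (simp add: x_def)
  qed
qed


section \<open>Refining the time grid\<close>

lemma sum_increments:
  fixes f :: "nat \<Rightarrow> 'b::ab_group_add"
  assumes "i \<le> k"
  shows "(\<Sum>l\<in>{i<..k}. f l - f (l - 1)) = f k - f i"
  using sum_telescope''[OF assms, of f] by (simp flip: atLeastSucAtMost_greaterThanAtMost)

text \<open>The coarse grid is \<open>g\<close> composed with \<open>s\<close>: \<open>s j\<close>
  is the position of coarse point \<open>j\<close> in the fine grid, and coarse interval
  \<open>j\<close> consists of the fine intervals \<open>{s (j - 1)<..s j}\<close>.\<close>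

locale grid_refinement =
  fixes m n :: nat and s :: "nat \<Rightarrow> nat" and g :: "nat \<Rightarrow> real"
  assumes s_0: "s 0 = 0" and s_m: "s m = n"
    and s_mono: "strict_mono_on {0..m} s"
    and g_mono: "strict_mono_on {0..n} g"
begin

text \<open>The coarse interval containing fine interval \<open>i\<close>. Intervals are identified
  by their right ends, so the index \<open>s j\<close> belongs to the block that it closes.\<close>

definition block :: "nat \<Rightarrow> nat" where "block i = (LEAST j. i \<le> s j)"

lemma s_less: "j < k \<Longrightarrow> k \<le> m \<Longrightarrow> s j < s k"
  by (rule strict_mono_onD[OF s_mono]) auto

lemma s_le: "j \<le> k \<Longrightarrow> k \<le> m \<Longrightarrow> s j \<le> s k"
  using s_less[of j k] by (cases "j = k") auto

lemma s_le_n: "j \<le> m \<Longrightarrow> s j \<le> n"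
  using s_le[of j m] s_m by simp

lemma g_less: "i < k \<Longrightarrow> k \<le> n \<Longrightarrow> g i < g k"
  by (rule strict_mono_onD[OF g_mono]) auto

lemma g_le: "i \<le> k \<Longrightarrow> k \<le> n \<Longrightarrow> g i \<le> g k"
  using g_less[of i k] by (cases "i = k") auto

lemma block_eqI:
  assumes "j \<in> {1..m}" "s (j - 1) < i" "i \<le> s j"
  shows "block i = j"
  unfolding block_def
proof (rule Least_equality)
  fix k assume "i \<le> s k"
  show "j \<le> k"
  proof (rule ccontr)
    assume "\<not> j \<le> k"
    then have "s k \<le> s (j - 1)" using assms by (intro s_le) auto
    then show False using assms \<open>i \<le> s k\<close> by simp
  qed
qed fact

lemma block_s: "j \<le> m \<Longrightarrow> block (s j) = j"
proof (cases "j = 0")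
  case True
  then show ?thesis unfolding block_def using s_0 by simp
qed (auto intro!: block_eqI s_less)

lemma block:
  assumes "i \<in> {1..n}"
  shows "block i \<in> {1..m}" "s (block i - 1) < i" "i \<le> s (block i)"
proof -
  have le: "i \<le> s m" using assms s_m by simp
  show "i \<le> s (block i)"
    unfolding block_def by (rule LeastI[of "\<lambda>j. i \<le> s j", OF le])
  moreover have "block i \<le> m"
    unfolding block_def by (rule Least_le) fact
  ultimately show block_mem: "block i \<in> {1..m}"
    using assms s_0 by (cases "block i") auto
  show "s (block i - 1) < i"
    using not_less_Least[of "block i - 1" "\<lambda>j. i \<le> s j"] block_mem
    by (fold block_def) auto
qed

lemma sum_blocks:
  fixes f :: "nat \<Rightarrow> 'b::comm_monoid_add"
  shows "(\<Sum>j\<in>{1..m}. \<Sum>i\<in>{s (j - 1)<..s j}. f i) = (\<Sum>i\<in>{1..n}. f i)"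
proof -
  have "(\<Sum>j\<in>{1..k}. \<Sum>i\<in>{s (j - 1)<..s j}. f i) = (\<Sum>i\<in>{0<..s k}. f i)" if "k \<le> m" for k
    using that
  proof (induction k)
    case (Suc k)
    have "{0<..s (Suc k)} = {0<..s k} \<union> {s k<..s (Suc k)}"
      using s_less[of k "Suc k"] Suc.prems by auto
    then have "sum f {0<..s (Suc k)} = sum f {0<..s k} + sum f {s k<..s (Suc k)}"
      by (simp add: sum.union_disjoint disjoint_iff)
    then show ?case using Suc by simp
  qed (simp add: s_0)
  then show ?thesis
    using s_m by (simp flip: atLeastSucAtMost_greaterThanAtMost)
qed

text \<open>No coarse point lies strictly inside a coarse interval, so comparing a coarse point with
  the right end of a fine interval is the same as comparing it with the right end of the surrounding
  block.\<close>

lemma less_iff_less_block: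
  assumes "i \<in> {1..n}" "k \<le> m"
  shows "g (s k) < g i \<longleftrightarrow> g (s k) < g (s (block i))"
proof
  note b = block[OF assms(1)]
  assume "g (s k) < g i"
  also have "g i \<le> g (s (block i))" using b by (intro g_le s_le_n) auto
  finally show "g (s k) < g (s (block i))" .
next
  note b = block[OF assms(1)]
  assume lt: "g (s k) < g (s (block i))"
  have "k < block i"
  proof (rule ccontr)
    assume "\<not> k < block i"
    then have "g (s (block i)) \<le> g (s k)" using assms by (intro g_le s_le s_le_n) auto
    then show False using lt by simp
  qed
  then have "s k \<le> s (block i - 1)" using b by (intro s_le) auto
  then show "g (s k) < g i" using b assms by (intro g_less) auto
qed

text \<open>When the balance equations of a block are added up, the intermediate storage levels
  telescope away. Sampling the levels at the coarse points is therefore consistent with summing the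
  arc flows.\<close>

lemma storage_flow_coarsen:
  assumes sf: "storage_flow I n x w"
  shows "storage_flow I m (\<lambda>a j. \<Sum>i\<in>{s (j - 1)<..s j}. x a i) (\<lambda>v j. w v (s j))"
proof -
  have in_range: "i \<in> {1..n}" if "j \<in> {1..m}" "i \<in> {s (j - 1)<..s j}" for i j
    using that s_le_n[of j] by auto
  have telescope: "(\<Sum>i\<in>{s (j - 1)<..s j}. w v i - w v (i - 1)) = w v (s j) - w v (s (j - 1))"
    if "j \<in> {1..m}" for v j
    using that s_le[of "j - 1" j] by (intro sum_increments) auto
  have conserve: "(\<Sum>a\<in>out_arcs (net I) v. x a i) + (w v i - w v (i - 1)) = (\<Sum>a\<in>in_arcs (net I) v. x a i)"
    if "v \<in> storage I" "i \<in> {1..n}" for v i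
  proof -
    have "(\<Sum>a\<in>out_arcs (net I) v. x a i) + w v i = (\<Sum>a\<in>in_arcs (net I) v. x a i) + w v (i - 1)"
      using sf that by (simp add: storage_flow_def)
    then show ?thesis by linarith
  qed
  have swap: "(\<Sum>a\<in>B. \<Sum>i\<in>{s (j - 1)<..s j}. x a i) = (\<Sum>i\<in>{s (j - 1)<..s j}. \<Sum>a\<in>B. x a i)" for B j
    by (rule sum.swap)
  have store: "(\<Sum>a\<in>out_arcs (net I) v. \<Sum>i\<in>{s (j - 1)<..s j}. x a i) + (w v (s j) - w v (s (j - 1)))
      = (\<Sum>a\<in>in_arcs (net I) v. \<Sum>i\<in>{s (j - 1)<..s j}. x a i)"
    if v: "v \<in> storage I" and j: "j \<in> {1..m}" for v j
    unfolding swap telescope[OF j, symmetric] sum.distrib[symmetric]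
    using conserve[OF v in_range[OF j]] by (intro sum.cong) auto
  have plain: "(\<Sum>a\<in>out_arcs (net I) v. \<Sum>i\<in>{s (j - 1)<..s j}. x a i)
      = (\<Sum>a\<in>in_arcs (net I) v. \<Sum>i\<in>{s (j - 1)<..s j}. x a i)"
    if v: "v \<in> verts (net I) - (storage I \<union> {source I, sink I})" and j: "j \<in> {1..m}" for v j
    unfolding swap
  proof (rule sum.cong[OF refl])
    fix i assume "i \<in> {s (j - 1)<..s j}"
    then have "i \<in> {1..n}" by (rule in_range[OF j])
    then show "(\<Sum>a\<in>out_arcs (net I) v. x a i) = (\<Sum>a\<in>in_arcs (net I) v. x a i)"
      using sf v by (simp add: storage_flow_def)
  qed
  have nonneg: "0 \<le> (\<Sum>i\<in>{s (j - 1)<..s j}. x a i)" if "a \<in> arcs (net I)" "j \<in> {1..m}" for a j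
    using that sf in_range by (intro sum_nonneg) (auto simp: storage_flow_def)
  have cap: "0 \<le> w v (s j) \<and> w v (s j) \<le> node_cap I v" if "v \<in> storage I" "j \<in> {0..m}" for v j
    using that sf s_le_n[of j] by (auto simp: storage_flow_def)
  show ?thesis
    unfolding storage_flow_def
  proof (intro conjI ballI)
    fix v j assume "v \<in> storage I" "j \<in> {1..m}"
    then show "(\<Sum>a\<in>out_arcs (net I) v. \<Sum>i\<in>{s (j - 1)<..s j}. x a i) + w v (s j)
      = (\<Sum>a\<in>in_arcs (net I) v. \<Sum>i\<in>{s (j - 1)<..s j}. x a i) + w v (s (j - 1))"
      using store[of v j] by linarith
  qed (use nonneg cap plain sf s_0 s_m in \<open>simp_all add: storage_flow_def\<close>)
qed

lemma flow_value_coarsen: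
  "flow_value I m (\<lambda>a j. \<Sum>i\<in>{s (j - 1)<..s j}. x a i) = flow_value I n x"
proof -
  have swap: "(\<Sum>a\<in>B. \<Sum>i\<in>{s (j - 1)<..s j}. x a i) = (\<Sum>i\<in>{s (j - 1)<..s j}. \<Sum>a\<in>B. x a i)" for B j
    by (rule sum.swap)
  show ?thesis
    unfolding flow_value_def swap sum_subtractf[symmetric] sum_blocks ..
qed

section \<open>Spreading a coarse flow over the fine grid\<close>

definition share :: "nat \<Rightarrow> real" where
  "share i = (g i - g (i - 1)) / (g (s (block i)) - g (s (block i - 1)))"

text \<open>At \<open>i = 0\<close> the block is \<open>0\<close> and the quotient is \<open>0 / 0 = 0\<close>, so no separate case is needed.\<close>

definition interpolate :: "(nat \<Rightarrow> real) \<Rightarrow> nat \<Rightarrow> real" where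
  "interpolate f i = f (block i - 1) +
     (g i - g (s (block i - 1))) / (g (s (block i)) - g (s (block i - 1))) * (f (block i) - f (block i - 1))"

lemma coarse_step_pos: "j \<in> {1..m} \<Longrightarrow> 0 < g (s j) - g (s (j - 1))"
  using g_less[of "s (j - 1)" "s j"] s_less[of "j - 1" j] s_le_n[of j] by auto

lemma share_nonneg: "i \<in> {1..n} \<Longrightarrow> 0 \<le> share i"
  unfolding share_def using g_le[of "i - 1" i] coarse_step_pos[OF block(1), of i]
  by (intro divide_nonneg_pos) auto

lemma interpolate_s:
  assumes "j \<le> m"
  shows "interpolate f (s j) = f j"
  using assms coarse_step_pos[of j]
  by (cases "j = 0") (auto simp: interpolate_def block_s)

text \<open>Storage levels change by the same fraction \<open>share i\<close> by which arc flows are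
  scaled, so each fine balance equation is a multiple of a coarse one.\<close>

lemma interpolate_diff:
  assumes "i \<in> {1..n}"
  shows "interpolate f i - interpolate f (i - 1) = share i * (f (block i) - f (block i - 1))"
proof -
  note b = block[OF assms] and pos = coarse_step_pos[OF block(1)[OF assms]]
  \<comment> \<open>The formula uses the block of \<open>i\<close> although \<open>i - 1\<close> may
    be the left end of that block, where \<open>block (i - 1)\<close> is \<open>block i - 1\<close>.
    There the two linear pieces agree.\<close>
  have "interpolate f (i - 1) = f (block i - 1) +
     (g (i - 1) - g (s (block i - 1))) / (g (s (block i)) - g (s (block i - 1))) * (f (block i) - f (block i - 1))"
  proof (cases "s (block i - 1) = i - 1")
    case True
    then show ?thesis
      using interpolate_s[of "block i - 1" f] b by (auto simp: block_s)
  next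
    case False
    then have "block (i - 1) = block i" using b by (intro block_eqI) auto
    then show ?thesis by (simp add: interpolate_def)
  qed
  then show ?thesis
    using pos by (simp add: interpolate_def share_def field_simps)
qed

lemma interpolate_bounds:
  assumes i: "i \<in> {0..n}" and f: "\<And>j. j \<in> {0..m} \<Longrightarrow> 0 \<le> f j \<and> f j \<le> C"
  shows "0 \<le> interpolate f i \<and> interpolate f i \<le> C"
proof (cases "i = 0")
  case True
  then show ?thesis using f[of 0] interpolate_s[of 0 f] s_0 by simp
next
  case False
  then have i: "i \<in> {1..n}" using i by auto
  note b = block[OF i] and pos = coarse_step_pos[OF block(1)[OF i]]
  define t where "t = (g i - g (s (block i - 1))) / (g (s (block i)) - g (s (block i - 1)))"
  have t: "0 \<le> t" "t \<le> 1"
    using pos g_le[of "s (block i - 1)" i] g_le[of i "s (block i)"] i b s_le_n[of "block i"]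
    by (auto simp: t_def divide_le_eq_1)
  have eq: "interpolate f i = (1 - t) * f (block i - 1) + t * f (block i)"
    unfolding interpolate_def t_def[symmetric] by (simp add: algebra_simps)
  have f': "0 \<le> f (block i - 1)" "f (block i - 1) \<le> C" "0 \<le> f (block i)" "f (block i) \<le> C"
    using f[of "block i - 1"] f[of "block i"] b by auto
  have "(1 - t) * f (block i - 1) + t * f (block i) \<le> C"
    using f' t by (intro convex_bound_le) auto
  then show ?thesis unfolding eq using f' t by simp
qed

lemma storage_flow_refine:
  assumes sf: "storage_flow I m x w"
  shows "storage_flow I n (\<lambda>a i. share i * x a (block i)) (\<lambda>v. interpolate (w v))"
proof -
  have ends: "interpolate (w v) 0 = 0" "interpolate (w v) n = 0" if "v \<in> storage I" for v
    using that sf interpolate_s[of 0 "w v"] interpolate_s[of m "w v"] s_0 s_m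
    by (simp_all add: storage_flow_def)
  have bounds: "0 \<le> interpolate (w v) i \<and> interpolate (w v) i \<le> node_cap I v"
    if "v \<in> storage I" "i \<in> {0..n}" for v i
    using that sf by (intro interpolate_bounds) (auto simp: storage_flow_def)
  have nonneg: "0 \<le> share i * x a (block i)" if "a \<in> arcs (net I)" "i \<in> {1..n}" for a i
    using that sf share_nonneg[of i] block[of i] by (auto simp: storage_flow_def)
  have plain: "(\<Sum>a\<in>out_arcs (net I) v. share i * x a (block i)) = (\<Sum>a\<in>in_arcs (net I) v. share i * x a (block i))"
    if "v \<in> verts (net I) - (storage I \<union> {source I, sink I})" "i \<in> {1..n}" for v i
    using that sf block[of i] by (simp add: storage_flow_def flip: sum_distrib_left)
  have store: "(\<Sum>a\<in>out_arcs (net I) v. share i * x a (block i)) + interpolate (w v) i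
      = (\<Sum>a\<in>in_arcs (net I) v. share i * x a (block i)) + interpolate (w v) (i - 1)"
    if v: "v \<in> storage I" and i: "i \<in> {1..n}" for v i
  proof -
    have "(\<Sum>a\<in>out_arcs (net I) v. x a (block i)) + w v (block i)
        = (\<Sum>a\<in>in_arcs (net I) v. x a (block i)) + w v (block i - 1)"
      using sf v block(1)[OF i] by (simp add: storage_flow_def)
    then have "w v (block i) - w v (block i - 1)
        = (\<Sum>a\<in>in_arcs (net I) v. x a (block i)) - (\<Sum>a\<in>out_arcs (net I) v. x a (block i))"
      by linarith
    then show ?thesis
      using interpolate_diff[OF i, of "w v"]
      by (simp add: right_diff_distrib flip: sum_distrib_left)
  qed
  show ?thesis
    unfolding storage_flow_def using ends bounds nonneg plain store by simp
qed

lemma sum_share: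
  assumes "j \<in> {1..m}"
  shows "(\<Sum>i\<in>{s (j - 1)<..s j}. share i * f (block i)) = (f j :: real)"
proof -
  have "(\<Sum>i\<in>{s (j - 1)<..s j}. share i * f (block i))
      = (\<Sum>i\<in>{s (j - 1)<..s j}. (g i - g (i - 1)) * (f j / (g (s j) - g (s (j - 1)))))"
    using block_eqI[OF assms] by (intro sum.cong) (auto simp: share_def)
  also have "\<dots> = (g (s j) - g (s (j - 1))) * (f j / (g (s j) - g (s (j - 1))))"
    using assms s_le[of "j - 1" j] s_le_n[of j]
    by (simp only: sum_distrib_right[symmetric]) (subst sum_increments, auto)
  finally show ?thesis using coarse_step_pos[OF assms] by simp
qed

text \<open>The shares of a block sum to 1, so coarsening the refined flow gives back the original
  one, and coarsening preserves the value.\<close>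

lemma flow_value_refine:
  "flow_value I n (\<lambda>a i. share i * x a (block i)) = flow_value I m x"
  using sum_share by (subst flow_value_coarsen[symmetric]) (intro flow_value_cong, blast)

text \<open>Both grids use the same flow rates \<open>r\<close>, which are constant on every coarse interval.\<close>

lemma bounded_flow_coarsen:
  assumes bf: "bounded_flow I n d x w"
    and d: "\<And>a i. a \<in> arcs (net I) \<Longrightarrow> i \<in> {1..n} \<Longrightarrow> d a i = (g i - g (i - 1)) * r a (block i)"
    and c: "\<And>a j. a \<in> arcs (net I) \<Longrightarrow> j \<in> {1..m} \<Longrightarrow> c a j = (g (s j) - g (s (j - 1))) * r a j"
  shows "bounded_flow I m c (\<lambda>a j. \<Sum>i\<in>{s (j - 1)<..s j}. x a i) (\<lambda>v j. w v (s j))"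
proof -
  have "(\<Sum>i\<in>{s (j - 1)<..s j}. x a i) \<le> c a j" if a: "a \<in> arcs (net I)" and j: "j \<in> {1..m}" for a j
  proof -
    have "(\<Sum>i\<in>{s (j - 1)<..s j}. x a i) \<le> (\<Sum>i\<in>{s (j - 1)<..s j}. (g i - g (i - 1)) * r a j)"
    proof (rule sum_mono)
      fix i assume i: "i \<in> {s (j - 1)<..s j}"
      then have "i \<in> {1..n}" "block i = j" using j s_le_n[of j] block_eqI[of j i] by auto
      then show "x a i \<le> (g i - g (i - 1)) * r a j"
        using bf a d[of a i] unfolding bounded_flow_def by fastforce
    qed
    also have "\<dots> = c a j"
      using j s_le[of "j - 1" j] s_le_n[of j]
      by (simp only: sum_distrib_right[symmetric] c[OF a j]) (subst sum_increments, auto)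
    finally show ?thesis .
  qed
  then show ?thesis
    using bf storage_flow_coarsen unfolding bounded_flow_def by blast
qed

lemma bounded_flow_refine:
  assumes bf: "bounded_flow I m c x w"
    and d: "\<And>a i. a \<in> arcs (net I) \<Longrightarrow> i \<in> {1..n} \<Longrightarrow> d a i = (g i - g (i - 1)) * r a (block i)"
    and c: "\<And>a j. a \<in> arcs (net I) \<Longrightarrow> j \<in> {1..m} \<Longrightarrow> c a j = (g (s j) - g (s (j - 1))) * r a j"
  shows "bounded_flow I n d (\<lambda>a i. share i * x a (block i)) (\<lambda>v. interpolate (w v))"
proof -
  have "share i * x a (block i) \<le> d a i" if a: "a \<in> arcs (net I)" and i: "i \<in> {1..n}" for a i
  proof -
    have "x a (block i) \<le> (g (s (block i)) - g (s (block i - 1))) * r a (block i)"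
      using bf a block(1)[OF i] c[OF a block(1)[OF i]] by (force simp: bounded_flow_def)
    then have "share i * x a (block i) \<le> share i * ((g (s (block i)) - g (s (block i - 1))) * r a (block i))"
      using share_nonneg[OF i] by (rule mult_left_mono)
    also have "\<dots> = d a i"
      using coarse_step_pos[OF block(1)[OF i]] by (simp add: share_def d[OF a i])
    finally show ?thesis .
  qed
  then show ?thesis
    using bf storage_flow_refine unfolding bounded_flow_def by blast
qed

end


section \<open>The value of a schedule on a refined grid\<close>

text \<open>The test for a closed interval looks only at its right end, as in
  \<open>closed_intervals\<close>, but it is stated for an arbitrary grid so that breakpoints and
  discretization can share it.\<close>

definition closed_rate ::
  "('v, 'a) maintenance \<Rightarrow> ('a \<Rightarrow> real) \<Rightarrow> (nat \<Rightarrow> real) \<Rightarrow> 'a \<Rightarrow> nat \<Rightarrow> real" where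
  "closed_rate I ts g a i =
     (if a \<in> jobs I \<and> ts a < g i \<and> g i \<le> ts a + proc I a then 0 else arc_cap I a)"

definition closed_cap ::
  "('v, 'a) maintenance \<Rightarrow> ('a \<Rightarrow> real) \<Rightarrow> (nat \<Rightarrow> real) \<Rightarrow> 'a \<Rightarrow> nat \<Rightarrow> real" where
  "closed_cap I ts g a i = (g i - g (i - 1)) * closed_rate I ts g a i"

lemma schedules_bounds:
  assumes "maintenance_instance I" "ts \<in> schedules I" "a \<in> jobs I"
  shows "release I a \<le> ts a" "ts a + proc I a \<le> deadline I a"
    "0 \<le> ts a" "ts a + proc I a \<le> horizon I" "0 < proc I a"
  using assms by (force simp: schedules_def maintenance_instance_def dest!: PiE_mem)+

lemma finite_breakpoints:
  assumes "maintenance_instance I"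
  shows "finite (breakpoints I ts)"
proof -
  have "finite (jobs I)"
    using assms unfolding maintenance_instance_def
    by (meson fin_digraph.finite_arcs finite_subset)
  then show ?thesis by (simp add: breakpoints_def)
qed

lemma breakpoints_bounds:
  assumes "maintenance_instance I" "ts \<in> schedules I" "b \<in> breakpoints I ts"
  shows "0 \<le> b \<and> b \<le> horizon I"
proof -
  have "0 < horizon I" using assms(1) by (simp add: maintenance_instance_def)
  then show ?thesis
    using assms(3) schedules_bounds[OF assms(1,2)] by (force simp: breakpoints_def)
qed

lemma discretization_less_iff:
  assumes "discretization I n g" "i \<le> n" "k \<le> n"
  shows "g i < g k \<longleftrightarrow> i < k"
  using assms by (intro strict_mono_on_less) (auto simp: discretization_def)

lemma discretization_le_iff:
  assumes "discretization I n g" "i \<le> n" "k \<le> n"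
  shows "g i \<le> g k \<longleftrightarrow> i \<le> k"
  using discretization_less_iff[OF assms(1,3,2)] by linarith

lemma tau_image:
  assumes "maintenance_instance I"
  shows "tau I ts ` {0..num_intervals I ts} = breakpoints I ts"
proof -
  note fin = finite_breakpoints[OF assms, of ts]
  have "0 < card (breakpoints I ts)"
    using fin by (auto simp: card_gt_0_iff breakpoints_def)
  then have "{0..num_intervals I ts} = {..<card (breakpoints I ts)}"
    by (auto simp: num_intervals_def)
  then have "tau I ts ` {0..num_intervals I ts} = set (sorted_list_of_set (breakpoints I ts))"
    unfolding set_conv_nth tau_def by (auto simp: image_iff)
  then show ?thesis using fin by simp
qed

text \<open>Release times and deadlines keep all breakpoints in \<open>[0, T]\<close>. Since 0 and
  \<open>T\<close> are breakpoints themselves, they come first and last in the enumeration.\<close>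

lemma discretization_tau:
  assumes inst: "maintenance_instance I" and ts: "ts \<in> schedules I"
  shows "discretization I (num_intervals I ts) (tau I ts)"
proof -
  let ?B = "breakpoints I ts" and ?m = "num_intervals I ts"
  note img = tau_image[OF inst, of ts]
  have "0 < card ?B"
    using finite_breakpoints[OF inst, of ts] by (auto simp: card_gt_0_iff breakpoints_def)
  then have mono: "strict_mono_on {0..?m} (tau I ts)"
    unfolding tau_def num_intervals_def
    by (intro strict_mono_onI sorted_wrt_nth_less[OF strict_sorted_list_of_set]) auto
  have le: "tau I ts i \<le> tau I ts k" if "i \<le> k" "k \<le> ?m" for i k
    using strict_mono_on_leD[OF mono, of i k] that by simp
  have bounds: "0 \<le> tau I ts i \<and> tau I ts i \<le> horizon I" if "i \<le> ?m" for i
    using that img by (intro breakpoints_bounds[OF inst ts]) auto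
  have "0 \<in> ?B" "horizon I \<in> ?B" by (simp_all add: breakpoints_def)
  then obtain i k where "i \<le> ?m" "tau I ts i = 0" "k \<le> ?m" "tau I ts k = horizon I"
    unfolding img[symmetric] by auto
  then have "tau I ts 0 = 0" "tau I ts ?m = horizon I"
    using bounds[of 0] bounds[of ?m] le[of 0 i] le[of k ?m] by auto
  then show ?thesis using mono by (simp add: discretization_def)
qed

lemma discretization_refinement:
  assumes h: "discretization I m h" and g: "discretization I n g"
    and sub: "h ` {0..m} \<subseteq> g ` {0..n}"
  obtains s where "grid_refinement m n s g" "\<And>j. j \<le> m \<Longrightarrow> g (s j) = h j"
proof -
  have "\<forall>j. \<exists>i. j \<le> m \<longrightarrow> i \<le> n \<and> g i = h j"
    using sub by (fastforce simp: image_subset_iff image_iff)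
  then obtain s where s: "\<And>j. j \<le> m \<Longrightarrow> s j \<le> n \<and> g (s j) = h j"
    by metis
  have eqI: "i = k" if "g i = g k" "i \<le> n" "k \<le> n" for i k
    using that discretization_less_iff[OF g, of i k] discretization_less_iff[OF g, of k i] by auto
  have "grid_refinement m n s g"
  proof
    show "s 0 = 0" "s m = n"
      using s[of 0] s[of m] g h by (auto simp: discretization_def intro!: eqI)
    show "strict_mono_on {0..m} s"
    proof (rule strict_mono_onI)
      fix j k assume "j \<in> {0..m}" "k \<in> {0..m}" "j < k"
      then show "s j < s k"
        using s[of j] s[of k] discretization_less_iff[OF h, of j k]
          discretization_less_iff[OF g, of "s j" "s k"] by auto
    qed
    show "strict_mono_on {0..n} g" using g by (simp add: discretization_def)
  qed
  then show thesis using s that by blast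
qed

text \<open>On closed intervals the equation \<open>x a i = 0\<close> and the bound
  \<open>x a i \<le> 0\<close> agree only by nonnegativity of the flow, hence the equivalence of the
  capacity conditions is proved under \<open>storage_flow\<close>.\<close>

lemma schedule_flow_iff_bounded_flow:
  assumes "maintenance_instance I"
  shows "schedule_flow I ts x w \<longleftrightarrow>
    bounded_flow I (num_intervals I ts) (closed_cap I ts (tau I ts)) x w"
proof -
  let ?m = "num_intervals I ts"
  have jobs: "jobs I \<subseteq> arcs (net I)" using assms by (simp add: maintenance_instance_def)
  have "(\<forall>a\<in>arcs (net I) - jobs I. \<forall>i\<in>{1..?m}. x a i \<le> (tau I ts i - tau I ts (i - 1)) * arc_cap I a) \<and>
      (\<forall>a\<in>jobs I. \<forall>i\<in>{1..?m} - closed_intervals I ts a. x a i \<le> (tau I ts i - tau I ts (i - 1)) * arc_cap I a) \<and>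
      (\<forall>a\<in>jobs I. \<forall>i\<in>closed_intervals I ts a. x a i = 0) \<longleftrightarrow>
      (\<forall>a\<in>arcs (net I). \<forall>i\<in>{1..?m}. x a i \<le> closed_cap I ts (tau I ts) a i)"
    (is "?A \<and> ?B \<and> ?C \<longleftrightarrow> ?D") if sf: "storage_flow I ?m x w"
  proof
    assume *: "?A \<and> ?B \<and> ?C"
    show ?D
    proof (intro ballI)
      fix a i assume "a \<in> arcs (net I)" "i \<in> {1..?m}"
      then show "x a i \<le> closed_cap I ts (tau I ts) a i"
        using * by (cases "a \<in> jobs I"; cases "i \<in> closed_intervals I ts a")
          (auto simp: closed_cap_def closed_rate_def closed_intervals_def)
    qed
  next
    assume D: ?D
    have "x a i = 0" if "a \<in> jobs I" "i \<in> closed_intervals I ts a" for a i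
    proof (rule antisym)
      show "x a i \<le> 0"
        using D[rule_format, of a i] that jobs
        by (auto simp: closed_cap_def closed_rate_def closed_intervals_def)
      show "0 \<le> x a i"
        using sf that jobs by (auto simp: storage_flow_def closed_intervals_def)
    qed
    moreover have "x a i \<le> (tau I ts i - tau I ts (i - 1)) * arc_cap I a"
      if "a \<in> arcs (net I)" "i \<in> {1..?m}" "a \<in> jobs I \<Longrightarrow> i \<notin> closed_intervals I ts a" for a i
      using D[rule_format, of a i] that
      by (auto simp: closed_cap_def closed_rate_def closed_intervals_def split: if_splits)
    ultimately show "?A \<and> ?B \<and> ?C" using jobs by blast
  qed
  then show ?thesis unfolding schedule_flow_def bounded_flow_def by blast
qed

section \<open>Attainment of the value of a schedule\<close>

lemma closed_cap_nonneg:
  assumes "maintenance_instance I" "discretization I n g" "a \<in> arcs (net I)" "i \<in> {1..n}"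
  shows "0 \<le> closed_cap I ts g a i"
proof -
  have "g (i - 1) \<le> g i" using assms discretization_le_iff[OF assms(2), of "i - 1" i] by auto
  then show ?thesis
    using assms by (auto simp: closed_cap_def closed_rate_def maintenance_instance_def)
qed

lemma schedule_value_maximum:
  assumes inst: "maintenance_instance I" and ts: "ts \<in> schedules I"
  defines "m \<equiv> num_intervals I ts" and "c \<equiv> closed_cap I ts (tau I ts)"
  shows "\<exists>x w. bounded_flow I m c x w \<and> schedule_value I ts = flow_value I m x"
    and "bounded_flow I m c x w \<Longrightarrow> flow_value I m x \<le> schedule_value I ts"
proof -
  have "0 \<le> c a i" if "a \<in> arcs (net I)" "i \<in> {1..m}" for a i
    using closed_cap_nonneg[OF inst discretization_tau[OF inst ts]] that by (simp add: c_def m_def)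
  moreover have "0 \<le> node_cap I v" if "v \<in> storage I" for v
    using inst that by (simp add: maintenance_instance_def)
  ultimately obtain x w where xw: "bounded_flow I m c x w"
    "\<And>x' w'. bounded_flow I m c x' w' \<Longrightarrow> flow_value I m x' \<le> flow_value I m x"
    using bounded_flow_maximum[of I m c] by blast
  then have eq: "schedule_value I ts = flow_value I m x"
    unfolding schedule_value_def schedule_flow_iff_bounded_flow[OF inst] m_def[symmetric] c_def[symmetric]
    by (intro Greatest_equality) blast+
  show "\<exists>x w. bounded_flow I m c x w \<and> schedule_value I ts = flow_value I m x"
    using xw eq by blast
  show "flow_value I m x \<le> schedule_value I ts" if "bounded_flow I m c x w" for x w
    using xw eq that by simp
qed

context grid_refinement
begin

text \<open>A job starts and ends at coarse points, so its arc cannot change state inside a coarse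
  interval. Both comparisons in \<open>closed_rate\<close> are of the form \<open>b < g i\<close> or
  its negation with \<open>b\<close> a coarse point, so one equivalence covers them.\<close>

lemma closed_rate_block:
  assumes h: "\<And>j. j \<le> m \<Longrightarrow> g (s j) = h j"
    and pts: "a \<in> jobs I \<Longrightarrow> ts a \<in> h ` {0..m}" "a \<in> jobs I \<Longrightarrow> ts a + proc I a \<in> h ` {0..m}"
    and i: "i \<in> {1..n}"
  shows "closed_rate I ts g a i = closed_rate I ts h a (block i)"
proof -
  have less: "b < g i \<longleftrightarrow> b < h (block i)" if b: "b \<in> h ` {0..m}" for b
  proof -
    obtain k where "k \<le> m" "b = h k" using b by auto
    then show ?thesis
      using less_iff_less_block[OF i, of k] h[of k] h[of "block i"] block(1)[OF i] by simp
  qed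
  show ?thesis
    using less[OF pts(1)] less[OF pts(2)] unfolding closed_rate_def not_less[symmetric] by auto
qed

lemma closed_cap_coarse:
  assumes h: "\<And>j. j \<le> m \<Longrightarrow> g (s j) = h j" and j: "j \<in> {1..m}"
  shows "closed_cap I ts h a j = (g (s j) - g (s (j - 1))) * closed_rate I ts h a j"
proof -
  have "g (s j) = h j" "g (s (j - 1)) = h (j - 1)" using j by (auto intro!: h)
  then show ?thesis unfolding closed_cap_def by (simp only:)
qed

end

text \<open>The last clause writes the fine bounds as fine lengths times coarse rates, as
  \<open>bounded_flow_coarsen\<close> and \<open>bounded_flow_refine\<close> expect.\<close>

lemma tau_refinement:
  assumes inst: "maintenance_instance I" and ts: "ts \<in> schedules I"
    and g: "discretization I n g" and sub: "breakpoints I ts \<subseteq> g ` {0..n}"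
  obtains s where "grid_refinement (num_intervals I ts) n s g"
    "\<And>j. j \<le> num_intervals I ts \<Longrightarrow> g (s j) = tau I ts j"
    "\<And>a i. i \<in> {1..n} \<Longrightarrow> closed_cap I ts g a i =
       (g i - g (i - 1)) * closed_rate I ts (tau I ts) a (grid_refinement.block s i)"
proof -
  note img = tau_image[OF inst, of ts]
  obtain s where s: "grid_refinement (num_intervals I ts) n s g"
    "\<And>j. j \<le> num_intervals I ts \<Longrightarrow> g (s j) = tau I ts j"
    using discretization_refinement[OF discretization_tau[OF inst ts] g] sub img by metis
  have "closed_rate I ts g a i = closed_rate I ts (tau I ts) a (grid_refinement.block s i)"
    if i: "i \<in> {1..n}" for a i
  proof (rule grid_refinement.closed_rate_block[OF s _ _ i])
    show "ts a \<in> tau I ts ` {0..num_intervals I ts}" "ts a + proc I a \<in> tau I ts ` {0..num_intervals I ts}"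
      if "a \<in> jobs I"
      using that unfolding img by (auto simp: breakpoints_def)
  qed
  then show thesis using s that by (simp add: closed_cap_def)
qed

lemma flow_value_le_schedule_value:
  assumes inst: "maintenance_instance I" and ts: "ts \<in> schedules I"
    and g: "discretization I n g" and sub: "breakpoints I ts \<subseteq> g ` {0..n}"
    and bf: "bounded_flow I n (closed_cap I ts g) x w"
  shows "flow_value I n x \<le> schedule_value I ts"
proof -
  let ?m = "num_intervals I ts"
  obtain s where s: "grid_refinement ?m n s g" "\<And>j. j \<le> ?m \<Longrightarrow> g (s j) = tau I ts j"
    and cap: "\<And>a i. i \<in> {1..n} \<Longrightarrow> closed_cap I ts g a i =
       (g i - g (i - 1)) * closed_rate I ts (tau I ts) a (grid_refinement.block s i)"
    using tau_refinement[OF inst ts g sub] by metis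
  interpret grid_refinement ?m n s g by (rule s)
  have "bounded_flow I ?m (closed_cap I ts (tau I ts))
      (\<lambda>a j. \<Sum>i\<in>{s (j - 1)<..s j}. x a i) (\<lambda>v j. w v (s j))"
    by (rule bounded_flow_coarsen[OF bf cap closed_cap_coarse[OF s(2)]])
  then show ?thesis
    using schedule_value_maximum(2)[OF inst ts] by (simp only: flow_value_coarsen[symmetric])
qed

text \<open>Coarsening gave the upper bound \<open>flow_value_le_schedule_value\<close>; refining an
  optimal coarse flow shows that it is sharp.\<close>

lemma schedule_value_attained_on_refined_grid:
  assumes inst: "maintenance_instance I" and ts: "ts \<in> schedules I"
    and g: "discretization I n g" and sub: "breakpoints I ts \<subseteq> g ` {0..n}"
  obtains x w where "bounded_flow I n (closed_cap I ts g) x w" "flow_value I n x = schedule_value I ts"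
proof -
  let ?m = "num_intervals I ts"
  obtain s where s: "grid_refinement ?m n s g" "\<And>j. j \<le> ?m \<Longrightarrow> g (s j) = tau I ts j"
    and cap: "\<And>a i. i \<in> {1..n} \<Longrightarrow> closed_cap I ts g a i =
       (g i - g (i - 1)) * closed_rate I ts (tau I ts) a (grid_refinement.block s i)"
    using tau_refinement[OF inst ts g sub] by metis
  interpret grid_refinement ?m n s g by (rule s)
  obtain x w where xw: "bounded_flow I ?m (closed_cap I ts (tau I ts)) x w"
    "schedule_value I ts = flow_value I ?m x"
    using schedule_value_maximum(1)[OF inst ts] by blast
  show thesis
  proof
    show "bounded_flow I n (closed_cap I ts g) (\<lambda>a i. share i * x a (block i)) (\<lambda>v. interpolate (w v))"
      by (rule bounded_flow_refine[OF xw(1) cap closed_cap_coarse[OF s(2)]])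
    show "flow_value I n (\<lambda>a i. share i * x a (block i)) = schedule_value I ts"
      by (simp add: flow_value_refine xw(2))
  qed
qed


section \<open>The lower bound program\<close>

text \<open>A start time that is a grid point in the window of its job has its completion time on
  the grid, by the forward closure condition of \<open>conformal\<close>.\<close>

lemma conformal_breakpoints_subset:
  assumes inst: "maintenance_instance I" and ts: "ts \<in> schedules I"
    and g: "discretization I n g" and conf: "conformal I n g"
    and grid: "ts ` jobs I \<subseteq> g ` {0..n}"
  shows "breakpoints I ts \<subseteq> g ` {0..n}"
proof -
  have "ts a + proc I a \<in> g ` {0..n}" if a: "a \<in> jobs I" for a
  proof -
    obtain i where "i \<in> {0..n}" "ts a = g i" using grid a by blast
    then show ?thesis
      using conf a schedules_bounds[OF inst ts a] by (auto simp: conformal_def)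
  qed
  moreover have "g 0 = 0" "g n = horizon I" using g by (simp_all add: discretization_def)
  then have "0 \<in> g ` {0..n}" "horizon I \<in> g ` {0..n}" by force+
  ultimately show ?thesis using grid by (auto simp: breakpoints_def)
qed

section \<open>From feasible points of the program to schedules\<close>

lemma zero_one_sum_eq_1:
  fixes f :: "'b \<Rightarrow> real"
  assumes "finite S" "\<And>k. k \<in> S \<Longrightarrow> f k \<in> {0, 1}" "sum f S = 1"
  obtains k where "k \<in> S" "\<And>j. j \<in> S \<Longrightarrow> f j = (if j = k then 1 else 0)"
proof -
  obtain k where k: "k \<in> S" "f k = 1"
    using assms by (metis empty_iff insert_iff sum.neutral zero_neq_one)
  then have "sum f (S - {k}) = 0"
    using assms by (simp add: sum.remove)
  then have "f j = 0" if "j \<in> S - {k}" for j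
    using that assms sum_nonneg_eq_0_iff[of "S - {k}" f] by fastforce
  then show thesis using k that by auto
qed

lemma finite_start_set [simp]: "finite (start_set I n g a)"
  by (simp add: start_set_def)

text \<open>Index \<open>k\<close> in \<open>start_set\<close> stands for a start at
  \<open>g (k - 1)\<close>, while membership only gives \<open>release I a < g k\<close>. As the
  release time is itself a grid point, it cannot fall strictly between the two.\<close>

lemma release_le_pred_grid:
  assumes g: "discretization I n g" and conf: "conformal I n g"
    and "a \<in> jobs I" "k \<in> {1..n}" "release I a < g k"
  shows "release I a \<le> g (k - 1)"
proof -
  obtain i where "i \<le> n" "g i = release I a"
  proof -
    have "release I a \<in> g ` {0..n}"
      using conf \<open>a \<in> jobs I\<close> unfolding conformal_def by blast
    then show thesis using that by auto
  qed
  then show ?thesis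
    using assms(4,5) discretization_less_iff[OF g, of i k] discretization_le_iff[OF g, of i "k - 1"] by auto
qed

text \<open>For the bounds on \<open>x\<close> it suffices that \<open>z\<close> is 1 on every
  interval closed under the schedule. On all other intervals \<open>z \<ge> 0\<close>, or the
  constraint outside \<open>process_set\<close>, already gives the full capacity bound.\<close>

lemma lower_bound_feasible_schedule:
  assumes inst: "maintenance_instance I" and g: "discretization I n g" and conf: "conformal I n g"
    and feas: "lower_bound_feasible I n g x w y z"
  obtains ts where "ts \<in> schedules I" "ts ` jobs I \<subseteq> g ` {0..n}"
    "bounded_flow I n (closed_cap I ts g) x w"
proof -
  have "\<exists>k. k \<in> start_set I n g a \<and> (\<forall>j\<in>start_set I n g a. y a j = (if j = k then 1 else 0))"
    if a: "a \<in> jobs I" for a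
  proof -
    have "y a j \<in> {0, 1}" if "j \<in> start_set I n g a" for j
      using feas a that unfolding lower_bound_feasible_def by blast
    moreover have "sum (y a) (start_set I n g a) = 1"
      using feas a unfolding lower_bound_feasible_def by blast
    ultimately show ?thesis
      using zero_one_sum_eq_1[OF finite_start_set] by metis
  qed
  then obtain k where k: "\<And>a. a \<in> jobs I \<Longrightarrow> k a \<in> start_set I n g a"
    and y: "\<And>a j. a \<in> jobs I \<Longrightarrow> j \<in> start_set I n g a \<Longrightarrow> y a j = (if j = k a then 1 else 0)"
    by metis
  \<comment> \<open>The left end of the chosen interval is the start time that \<open>P_set\<close>
    attributes to it. The restriction to \<open>jobs I\<close> matches the extensional product in
    \<open>schedules\<close>.\<close>
  define ts where "ts = (\<lambda>a\<in>jobs I. g (k a - 1))"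
  have k': "k a \<in> {1..n}" "release I a < g (k a)" "g (k a - 1) \<le> deadline I a - proc I a"
    if "a \<in> jobs I" for a
    using k[OF that] by (auto simp: start_set_def)
  have z: "z a i = (if k a \<in> P_set I n g a i then 1 else 0)"
    if a: "a \<in> jobs I" and i: "i \<in> process_set I n g a" for a i
  proof -
    have sub: "P_set I n g a i \<subseteq> start_set I n g a" by (auto simp: P_set_def)
    have "z a i = (\<Sum>j\<in>P_set I n g a i. y a j)"
      using feas a i by (simp add: lower_bound_feasible_def)
    also have "\<dots> = (\<Sum>j\<in>P_set I n g a i. if j = k a then 1 else 0)"
      using sub y[OF a] by (intro sum.cong) auto
    also have "\<dots> = (if k a \<in> P_set I n g a i then 1 else 0)"
      using finite_subset[OF sub] by simp
    finally show ?thesis .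
  qed
  have sched: "ts \<in> schedules I"
    using k' release_le_pred_grid[OF g conf _ k'(1,2)] by (auto simp: schedules_def ts_def)
  moreover have "ts ` jobs I \<subseteq> g ` {0..n}"
    using k'(1) by (fastforce simp: ts_def)
  moreover have "bounded_flow I n (closed_cap I ts g) x w"
    unfolding bounded_flow_def
  proof (intro conjI ballI)
    show "storage_flow I n x w" using feas by (simp add: lower_bound_feasible_def)
    fix a i assume a: "a \<in> arcs (net I)" and i: "i \<in> {1..n}"
    show "x a i \<le> closed_cap I ts g a i"
    proof (cases "a \<in> jobs I \<and> ts a < g i \<and> g i \<le> ts a + proc I a")
      case True
      then have job: "a \<in> jobs I" by simp
      note b = schedules_bounds[OF inst sched job]
      have pred: "g (i - 1) < g i" using i discretization_less_iff[OF g, of "i - 1" i] by auto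
      have proc: "i \<in> process_set I n g a"
        using True b pred i by (auto simp: process_set_def)
      \<comment> \<open>Between grid points, lying below \<open>g i\<close> means lying at or below
        \<open>g (i - 1)\<close>, which is the form required by \<open>P_set\<close>.\<close>
      have "g (k a - 1) < g i" using True job by (simp add: ts_def)
      then have "g (k a - 1) \<le> g (i - 1)"
      proof -
        have "k a - 1 \<le> n" "i - 1 \<le> n" "i \<le> n" using i k'(1)[OF job] by auto
        moreover from this have "k a - 1 < i"
          using \<open>g (k a - 1) < g i\<close> discretization_less_iff[OF g] by blast
        ultimately show ?thesis
          using discretization_le_iff[OF g, of "k a - 1" "i - 1"] by linarith
      qed
      then have "k a \<in> P_set I n g a i"
        using True k[OF job] job by (simp add: P_set_def ts_def)
      then have "z a i = 1" using z[OF job proc] by simp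
      moreover have "x a i \<le> (g i - g (i - 1)) * (1 - z a i) * arc_cap I a"
        using feas job proc unfolding lower_bound_feasible_def by blast
      ultimately show ?thesis using True by (simp add: closed_cap_def closed_rate_def)
    next
      case False
      have step: "0 \<le> g i - g (i - 1)" using i discretization_le_iff[OF g, of "i - 1" i] by auto
      have cap: "0 \<le> arc_cap I a" using inst a by (simp add: maintenance_instance_def)
      have "x a i \<le> (g i - g (i - 1)) * arc_cap I a"
      proof (cases "a \<in> jobs I \<and> i \<in> process_set I n g a")
        case True
        then have "x a i \<le> (g i - g (i - 1)) * (1 - z a i) * arc_cap I a"
          using feas unfolding lower_bound_feasible_def by blast
        also have "\<dots> \<le> (g i - g (i - 1)) * 1 * arc_cap I a"
          using z True step cap by (intro mult_right_mono mult_left_mono) auto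
        finally show ?thesis by simp
      next
        case False
        then show ?thesis
          using feas a i unfolding lower_bound_feasible_def by blast
      qed
      then show ?thesis using False by (auto simp: closed_cap_def closed_rate_def)
    qed
  qed
  ultimately show thesis by (rule that)
qed

text \<open>Each job starts at a grid point \<open>g k\<close> and ends at a grid point
  \<open>g l\<close>, so it fills exactly the intervals \<open>{k<..l}\<close>. Their lengths
  telescope to the processing time, and no interval is processed only in part.\<close>

lemma schedule_lower_bound_feasible:
  assumes inst: "maintenance_instance I" and ts: "ts \<in> schedules I"
    and g: "discretization I n g" and conf: "conformal I n g"
    and grid: "ts ` jobs I \<subseteq> g ` {0..n}"
    and bf: "bounded_flow I n (closed_cap I ts g) x w"
  shows "lower_bound_feasible I n g x w (\<lambda>a k. of_bool (g (k - 1) = ts a))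
    (\<lambda>a i. of_bool (ts a < g i \<and> g i \<le> ts a + proc I a))"
    (is "lower_bound_feasible I n g x w ?y ?z")
proof -
  note less_iff = discretization_less_iff[OF g] and le_iff = discretization_le_iff[OF g]
  have jobs: "jobs I \<subseteq> arcs (net I)" using inst by (simp add: maintenance_instance_def)
  have eq_iff: "g i = g j \<longleftrightarrow> i = j" if "i \<le> n" "j \<le> n" for i j
    using that less_iff[of i j] less_iff[of j i] by auto
  have bp: "breakpoints I ts \<subseteq> g ` {0..n}"
    by (rule conformal_breakpoints_subset[OF inst ts g conf grid])
  have ex: "\<exists>k l. k < l \<and> l \<le> n \<and> g k = ts a \<and> g l = ts a + proc I a" if a: "a \<in> jobs I" for a
  proof -
    have "ts a \<in> g ` {0..n}" "ts a + proc I a \<in> g ` {0..n}"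
      using a bp by (auto simp: breakpoints_def)
    then obtain k l where "k \<le> n" "g k = ts a" "l \<le> n" "g l = ts a + proc I a" by fastforce
    then show ?thesis
      using schedules_bounds(5)[OF inst ts a] less_iff[of k l] by auto
  qed
  have bounds: "release I a \<le> ts a" "ts a + proc I a \<le> deadline I a" "0 < proc I a" if "a \<in> jobs I" for a
    using schedules_bounds[OF inst ts that] by auto
  \<comment> \<open>The start \<open>g k\<close> is the left end of interval \<open>Suc k\<close>.
    This interval exists because the positive processing time gives
    \<open>k < l \<le> n\<close>.\<close>
  have start: "\<exists>k\<in>start_set I n g a. \<forall>j\<in>start_set I n g a. g (j - 1) = ts a \<longleftrightarrow> j = k" if a: "a \<in> jobs I" for a
  proof -
    obtain k l where k: "k < l" "l \<le> n" "g k = ts a" "g l = ts a + proc I a" using ex[OF a] by blast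
    have "Suc k \<in> start_set I n g a"
      using k bounds[OF a] less_iff[of k "Suc k"] by (auto simp: start_set_def)
    moreover have "g (j - 1) = ts a \<longleftrightarrow> j = Suc k" if "j \<in> start_set I n g a" for j
      using that k eq_iff[of "j - 1" k] by (auto simp: start_set_def)
    ultimately show ?thesis by blast
  qed
  \<comment> \<open>\<open>S\<close> may be any set of intervals containing all processed ones, so
    that the claim serves for both \<open>process_set\<close> and \<open>Q_set\<close>.\<close>
  have total: "(\<Sum>i\<in>S. (g i - g (i - 1)) * ?z a i) = proc I a"
    if a: "a \<in> jobs I" and S: "S \<subseteq> {1..n}" "\<And>i. i \<in> {1..n} \<Longrightarrow> ts a < g i \<Longrightarrow> g i \<le> ts a + proc I a \<Longrightarrow> i \<in> S"
    for a S
  proof -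
    obtain k l where k: "k < l" "l \<le> n" "g k = ts a" "g l = ts a + proc I a" using ex[OF a] by blast
    have z: "ts a < g i \<and> g i \<le> ts a + proc I a \<longleftrightarrow> i \<in> {k<..l}" if "i \<in> {1..n}" for i
      using that k less_iff[of k i] le_iff[of i l] by auto
    have sub: "{k<..l} \<subseteq> S"
    proof
      fix i assume i: "i \<in> {k<..l}"
      then have "i \<in> {1..n}" "k \<le> n" using k by auto
      then show "i \<in> S"
        using S(2)[of i] i k less_iff[of k i] le_iff[of i l] by auto
    qed
    have "(\<Sum>i\<in>S. (g i - g (i - 1)) * ?z a i) = (\<Sum>i\<in>{k<..l}. (g i - g (i - 1)) * ?z a i)"
    proof (rule sum.mono_neutral_right)
      show "\<forall>i\<in>S - {k<..l}. (g i - g (i - 1)) * ?z a i = 0"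
        using S(1) z by (simp add: subset_iff)
    qed (use sub finite_subset[OF S(1)] in auto)
    also have "\<dots> = (\<Sum>i\<in>{k<..l}. g i - g (i - 1))"
      using z k by (intro sum.cong) auto
    also have "\<dots> = proc I a" using k by (subst sum_increments) auto
    finally show ?thesis .
  qed
  have step: "g (i - 1) < g i" if "i \<in> {1..n}" for i
    using that less_iff[of "i - 1" i] by auto
  have start_le: "ts a \<le> g (i - 1)" if a: "a \<in> jobs I" and i: "i \<in> {1..n}" "ts a < g i" for a i
  proof -
    obtain k l where "k < l" "l \<le> n" "g k = ts a" using ex[OF a] by blast
    then show ?thesis using i less_iff[of k i] le_iff[of k "i - 1"] by auto
  qed
  show ?thesis
    unfolding lower_bound_feasible_def
  proof (intro conjI ballI)
    show "storage_flow I n x w" using bf by (simp add: bounded_flow_def)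
  next
    fix a i show "?y a i \<in> {0, 1}" "?z a i \<in> {0, 1}" by auto
  next
    fix a i assume "a \<in> arcs (net I) - jobs I" "i \<in> {1..n}"
    then show "x a i \<le> (g i - g (i - 1)) * arc_cap I a"
      using bf by (fastforce simp: bounded_flow_def closed_cap_def closed_rate_def)
  next
    fix a assume "a \<in> jobs I"
    then obtain k where "k \<in> start_set I n g a" "\<forall>j\<in>start_set I n g a. g (j - 1) = ts a \<longleftrightarrow> j = k"
      using start by blast
    then show "(\<Sum>i\<in>start_set I n g a. ?y a i) = 1"
      by (simp add: of_bool_def)
  next
    fix a i assume a: "a \<in> jobs I" and i: "i \<in> process_set I n g a"
    \<comment> \<open>A processed interval lies within the window from release to deadline, so the
      right side is its full length. Otherwise membership in \<open>process_set\<close> makes the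
      right side nonnegative.\<close>
    show "(g i - g (i - 1)) * ?z a i \<le> min (g i) (deadline I a) - max (g (i - 1)) (release I a)"
      using i bounds[OF a] start_le[OF a, of i] step[of i] by (auto simp: process_set_def)
  next
    fix a assume a: "a \<in> jobs I"
    show "(\<Sum>i\<in>process_set I n g a. (g i - g (i - 1)) * ?z a i) = proc I a"
    proof (rule total[OF a])
      fix i assume "i \<in> {1..n}" "ts a < g i" "g i \<le> ts a + proc I a"
      then show "i \<in> process_set I n g a"
        using bounds[OF a] step[of i] by (auto simp: process_set_def)
    qed (auto simp: process_set_def)
  next
    fix a i assume a: "a \<in> jobs I" and i: "i \<in> start_set I n g a"
    then have i': "i \<in> {1..n}" by (simp add: start_set_def)
    show "proc I a * ?y a i \<le> (\<Sum>k\<in>Q_set I n g a i. (g k - g (k - 1)) * ?z a k)"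
    proof (cases "g (i - 1) = ts a")
      case True
      \<comment> \<open>\<open>Q_set\<close> extends up to \<open>g i + proc I a\<close>, which is
        later than the end \<open>g (i - 1) + proc I a\<close> of this job, so it contains every
        processed interval.\<close>
      have "(\<Sum>k\<in>Q_set I n g a i. (g k - g (k - 1)) * ?z a k) = proc I a"
      proof (rule total[OF a])
        fix k assume k: "k \<in> {1..n}" "ts a < g k" "g k \<le> ts a + proc I a"
        have "g (i - 1) < g k" using k True by simp
        then have "i \<le> k"
        proof -
          have "i - 1 \<le> n" "k \<le> n" using k i' by auto
          then have "i - 1 < k" using \<open>g (i - 1) < g k\<close> less_iff by blast
          then show ?thesis by linarith
        qed
        then show "k \<in> Q_set I n g a i"
          using bounds[OF a] step[of k] step[OF i'] k True by (auto simp: Q_set_def process_set_def)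
      qed (auto simp: Q_set_def process_set_def)
      then show ?thesis using True by simp
    next
      case False
      have "0 \<le> (\<Sum>k\<in>Q_set I n g a i. (g k - g (k - 1)) * ?z a k)"
        using step by (intro sum_nonneg mult_nonneg_nonneg) (auto simp: Q_set_def process_set_def less_imp_le)
      then show ?thesis using False by simp
    qed
  next
    fix a i assume a: "a \<in> jobs I" and i: "i \<in> process_set I n g a"
    then have i': "i \<in> {1..n}" by (simp add: process_set_def)
    obtain k where k: "k \<in> start_set I n g a" "\<And>j. j \<in> start_set I n g a \<Longrightarrow> g (j - 1) = ts a \<longleftrightarrow> j = k"
      using start[OF a] by blast
    have k_start: "g (k - 1) = ts a" using k(2)[OF k(1)] by simp
    have sub: "P_set I n g a i \<subseteq> start_set I n g a" by (auto simp: P_set_def)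
    have "(\<Sum>j\<in>P_set I n g a i. ?y a j) = (\<Sum>j\<in>P_set I n g a i. if j = k then 1 else 0)"
      using k(2) sub by (intro sum.cong) (auto simp: of_bool_def)
    also have "\<dots> = of_bool (k \<in> P_set I n g a i)"
      using finite_subset[OF sub] by simp
    also have "k \<in> P_set I n g a i \<longleftrightarrow> ts a < g i \<and> g i \<le> ts a + proc I a"
      using k(1) k_start start_le[OF a i'] step[OF i'] by (auto simp: P_set_def)
    finally show "?z a i = (\<Sum>k\<in>P_set I n g a i. ?y a k)" by simp
  next
    fix a i assume a: "a \<in> jobs I" and "i \<in> process_set I n g a"
    then have "a \<in> arcs (net I)" "i \<in> {1..n}" using jobs by (auto simp: process_set_def)
    then have "x a i \<le> closed_cap I ts g a i" using bf by (simp add: bounded_flow_def)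
    then show "x a i \<le> (g i - g (i - 1)) * (1 - ?z a i) * arc_cap I a"
      using a by (auto simp: closed_cap_def closed_rate_def)
  next
    fix a i assume a: "a \<in> jobs I" and i: "i \<in> {1..n} - process_set I n g a"
    then have "\<not> (ts a < g i \<and> g i \<le> ts a + proc I a)"
      using bounds[OF a] step[of i] by (auto simp: process_set_def)
    moreover have "x a i \<le> closed_cap I ts g a i"
      using bf a i jobs by (auto simp: bounded_flow_def)
    ultimately show "x a i \<le> (g i - g (i - 1)) * arc_cap I a"
      by (auto simp: closed_cap_def closed_rate_def)
  qed
qed

theorem mainTheorem7:
  fixes I :: "('v, 'a) maintenance"
    and tstar :: "'a \<Rightarrow> real"
    and n :: nat
    and g :: "nat \<Rightarrow> real"
  assumes "maintenance_instance I"
    and "optimal_schedule I tstar"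
    and "discretization I n g"
    and "conformal I n g"
    and "tstar ` jobs I \<subseteq> g ` {0..n}"
  shows "lower_bound_optimum I n g \<in> lower_bound_values I n g \<and>
         (\<forall>\<phi>\<in>lower_bound_values I n g. \<phi> \<le> lower_bound_optimum I n g) \<and>
         lower_bound_optimum I n g = schedule_value I tstar"
proof -
  note inst = assms(1) and g = assms(3) and conf = assms(4) and grid = assms(5)
  have tstar: "tstar \<in> schedules I"
    and opt: "\<And>ts. ts \<in> schedules I \<Longrightarrow> schedule_value I ts \<le> schedule_value I tstar"
    using assms(2) by (auto simp: optimal_schedule_def is_arg_max_def not_less)
  obtain x w where xw: "bounded_flow I n (closed_cap I tstar g) x w"
    "flow_value I n x = schedule_value I tstar"
    using schedule_value_attained_on_refined_grid[OF inst tstar g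
        conformal_breakpoints_subset[OF inst tstar g conf grid]] by blast
  have attained: "schedule_value I tstar \<in> lower_bound_values I n g"
    unfolding lower_bound_values_def
    using schedule_lower_bound_feasible[OF inst tstar g conf grid xw(1)] xw(2)[symmetric] by blast
  \<comment> \<open>The schedule read off from a feasible point may differ from
    \<open>tstar\<close>; optimality of \<open>tstar\<close> over all of \<open>schedules I\<close>
    compares the two.\<close>
  have upper: "\<phi> \<le> schedule_value I tstar" if \<phi>: "\<phi> \<in> lower_bound_values I n g" for \<phi>
  proof -
    obtain x w y z where "lower_bound_feasible I n g x w y z" and \<phi>: "\<phi> = flow_value I n x"
      using \<phi> by (auto simp: lower_bound_values_def)
    then obtain ts where ts: "ts \<in> schedules I" "ts ` jobs I \<subseteq> g ` {0..n}"
      and "bounded_flow I n (closed_cap I ts g) x w"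
      using lower_bound_feasible_schedule[OF inst g conf] by blast
    then have "\<phi> \<le> schedule_value I ts"
      unfolding \<phi> using conformal_breakpoints_subset[OF inst ts(1) g conf ts(2)]
      by (intro flow_value_le_schedule_value[OF inst _ g])
    also have "\<dots> \<le> schedule_value I tstar" by (rule opt) fact
    finally show ?thesis .
  qed
  have "lower_bound_optimum I n g = schedule_value I tstar"
    unfolding lower_bound_optimum_def by (rule Greatest_equality) (fact attained, rule upper)
  then show ?thesis using attained upper by simp
qed

end
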